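(* There are an absolute constant $C>0$ and an alternating learning dynamics (in the sense of the context) for two-player normal-form games such that, in every two-player normal-form game in which each player has at most $d$ actions and losses lie in $[-1,1]$, the iterates $(x_t)_{t\ge1},(y_t)_{t\ge1}$ of the dynamics satisfy, for every $T\ge1$: (1) if the game is zero-sum, the averaged strategy profile $\bigl(\frac1T\sum_{t=1}^Tx_t,\ \frac1T\sum_{t=1}^Ty_t\bigr)$ is an $\epsilon$-Nash equilibrium with $\epsilon\le C\log d/T$; (2) if the game is general-sum, the uniform distribution over the $2T$ profiles $(x_t,y_t),(x_{t+1},y_t)$, $t=1,\dots,T$ (counted with multiplicity), is an $\epsilon$-coarse correlated equilibrium with $\epsilon\le C\log d/T$.
   Context: A two-player normal-form game: strategy sets $\mathcal X=\Delta_{d_1}$, $\mathcal Y=\Delta_{d_2}$ are probability simplices (with $d_1,d_2\le d$) and the players' losses are $u_1(x,y)=x^\top Ay$, $u_2(x,y)=x^\top By$, with values in $[-1,1]$. It is zero-sum if $A=-B$, otherwise general-sum. Alternating learning dynamics: each player runs an online algorithm, which depends only on that player's own number of actions and on the loss functions that player has observed so far (not on the matrices $A,B$). In round $t\ge1$: first the $x$-player chooses $x_t\in\mathcal X$ based on $u_1(\cdot,y_1),\dots,u_1(\cdot,y_{t-1})$; then the $y$-player chooses $y_t\in\mathcal Y$ based on $u_2(x_1,\cdot),\dots,u_2(x_t,\cdot)$. A profile $(x,y)$ is an $\epsilon$-Nash equilibrium if $u_1(x,y)\le\min_{x'\in\mathcal X}u_1(x',y)+\epsilon$ and $u_2(x,y)\le\min_{y'\in\mathcal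 Y}u_2(x,y')+\epsilon$. A distribution $\sigma$ on $\mathcal X\times\mathcal Y$ is an $\epsilon$-coarse correlated equilibrium if $\mathbb E_\sigma[u_1(x,y)]\le\min_{x'\in\mathcal X}\mathbb E_\sigma[u_1(x',y)]+\epsilon$ and $\mathbb E_\sigma[u_2(x,y)]\le\min_{y'\in\mathcal Y}\mathbb E_\sigma[u_2(x,y')]+\epsilon$. *)

theory Defs
  imports "HOL-Probability.Probability_Mass_Function" "HOL-Library.Multiset" "Jordan_Normal_Form.Matrix"
begin

unbundle no inner_syntax and no vec_syntax
notation vec_index (infixl "$" 100) and scalar_prod (infix "\<bullet>" 70)
hide_type (open) Finite_Cartesian_Product.vec
hide_const (open) Finite_Cartesian_Product.vec

definition prob_simplex :: "nat \<Rightarrow> real vec set" where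
  "prob_simplex n = {x \<in> carrier_vec n. (\<forall>i<n. 0 \<le> x $ i) \<and> (\<Sum>i<n. x $ i) = 1}"

definition loss :: "real mat \<Rightarrow> real vec \<Rightarrow> real vec \<Rightarrow> real" where
  "loss M x y = x \<bullet> (M *\<^sub>v y)"

text \<open>Numbers of actions \<open>d1, d2 \<ge> 1\<close> (so that the simplices are nonempty), and
  losses \<open>u1 = loss A\<close>, \<open>u2 = loss B\<close>, both to be minimised.\<close>

definition normal_form_game :: "nat \<Rightarrow> nat \<Rightarrow> real mat \<Rightarrow> real mat \<Rightarrow> bool" where
  "normal_form_game d1 d2 A B \<longleftrightarrow>
     1 \<le> d1 \<and> 1 \<le> d2 \<and> A \<in> carrier_mat d1 d2 \<and> B \<in> carrier_mat d1 d2 \<and>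
     (\<forall>x\<in>prob_simplex d1. \<forall>y\<in>prob_simplex d2. loss A x y \<in> {-1..1} \<and> loss B x y \<in> {-1..1})"

definition zero_sum :: "real mat \<Rightarrow> real mat \<Rightarrow> bool" where
  "zero_sum A B \<longleftrightarrow> A = - B"

definition general_sum :: "real mat \<Rightarrow> real mat \<Rightarrow> bool" where
  "general_sum A B \<longleftrightarrow> \<not> zero_sum A B"

text \<open>An online algorithm maps the player's own number of actions and the loss functions
  observed so far, oldest first, to the next mixed strategy.\<close>

type_synonym algorithm = "nat \<Rightarrow> (real vec \<Rightarrow> real) list \<Rightarrow> real vec"

definition online_algorithm :: "algorithm \<Rightarrow> bool" where
  "online_algorithm alg \<longleftrightarrow> (\<forall>n\<ge>1. \<forall>fs. alg n fs \<in> prob_simplex n)"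

text \<open>Rounds are numbered from 1; the values at round 0 are irrelevant. The loss functions are
  restricted to the simplex, so that an algorithm sees their values on the player's own
  strategies and nothing else.\<close>

function play_x :: "algorithm \<Rightarrow> algorithm \<Rightarrow> nat \<Rightarrow> nat \<Rightarrow> real mat \<Rightarrow> real mat \<Rightarrow> nat \<Rightarrow> real vec"
  and play_y :: "algorithm \<Rightarrow> algorithm \<Rightarrow> nat \<Rightarrow> nat \<Rightarrow> real mat \<Rightarrow> real mat \<Rightarrow> nat \<Rightarrow> real vec"
where
  "play_x algx algy d1 d2 A B t =
     algx d1 (map (\<lambda>s. \<lambda>x\<in>prob_simplex d1. loss A x (play_y algx algy d1 d2 A B s)) [1..<t])"
| "play_y algx algy d1 d2 A B t =
     algy d2 (map (\<lambda>s. \<lambda>y\<in>prob_simplex d2. loss B (play_x algx algy d1 d2 A B s) y) [1..<Suc t])"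
  by pat_completeness auto
termination
  by (relation "Wellfounded.measure (case_sum (\<lambda>(_, _, _, _, _, _, t). 2 * t) (\<lambda>(_, _, _, _, _, _, t). Suc (2 * t)))")
     auto

declare play_x.simps [simp del] play_y.simps [simp del]

definition average :: "nat \<Rightarrow> nat \<Rightarrow> (nat \<Rightarrow> real vec) \<Rightarrow> real vec" where
  "average n T x = vec n (\<lambda>i. (\<Sum>t=1..T. x t $ i) / real T)"

definition nash_equilibrium ::
    "nat \<Rightarrow> nat \<Rightarrow> real mat \<Rightarrow> real mat \<Rightarrow> real \<Rightarrow> real vec \<times> real vec \<Rightarrow> bool" where
  "nash_equilibrium d1 d2 A B \<epsilon> = (\<lambda>(x, y).
     x \<in> prob_simplex d1 \<and> y \<in> prob_simplex d2 \<and>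
     (\<forall>x'\<in>prob_simplex d1. loss A x y \<le> loss A x' y + \<epsilon>) \<and>
     (\<forall>y'\<in>prob_simplex d2. loss B x y \<le> loss B x y' + \<epsilon>))"

definition coarse_correlated_equilibrium ::
    "nat \<Rightarrow> nat \<Rightarrow> real mat \<Rightarrow> real mat \<Rightarrow> real \<Rightarrow> (real vec \<times> real vec) pmf \<Rightarrow> bool" where
  "coarse_correlated_equilibrium d1 d2 A B \<epsilon> \<sigma> \<longleftrightarrow>
     set_pmf \<sigma> \<subseteq> prob_simplex d1 \<times> prob_simplex d2 \<and>
     (\<forall>x'\<in>prob_simplex d1. measure_pmf.expectation \<sigma> (\<lambda>(x, y). loss A x y)
        \<le> measure_pmf.expectation \<sigma> (\<lambda>(x, y). loss A x' y) + \<epsilon>) \<and>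
     (\<forall>y'\<in>prob_simplex d2. measure_pmf.expectation \<sigma> (\<lambda>(x, y). loss B x y)
        \<le> measure_pmf.expectation \<sigma> (\<lambda>(x, y). loss B x y') + \<epsilon>)"

definition alternating_profiles ::
    "nat \<Rightarrow> (nat \<Rightarrow> real vec) \<Rightarrow> (nat \<Rightarrow> real vec) \<Rightarrow> (real vec \<times> real vec) multiset" where
  "alternating_profiles T x y = (\<Sum>t=1..T. {#(x t, y t), (x (Suc t), y t)#})"

end

theory Submission
  imports Defs
begin

text \<open>In both roles a player's strategy is charged against the sum of the last observed loss vector
  \<open>l\<close> and the next, still unknown one \<open>l'\<close>; so it suffices to have constant regret against adversarial
  losses \<open>l + l'\<close>, where half of the loss is known in advance. With cumulative gains
  \<open>G = - (\<Sum> (l + l') / 2)\<close>, take the potential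
  \<open>\<Phi>(G, l, m) = (\<Sum>i. exp (\<eta> G\<^sub>i - \<eta>\<^sup>2 (l\<^sub>i - m)\<^sup>2))\<close>. A gain increment \<open>w\<close> forces \<open>l' = - l - 2 w\<close>, so the
  quadratic penalty drops by a term of order \<open>w\<^sup>2\<close>, which pays for the second-order error of the
  exponential; the first-order change of the penalty is absorbed into the strategy, a multiplicative
  perturbation of Hedge. It sums to one if \<open>m\<close> is the fixed point where \<open>m\<close> is the mean of \<open>l\<close> under
  the weights. Hence \<open>\<Phi>\<close>, for every \<open>m \<in> [-1, 1]\<close>, stays below \<open>n\<close> times the exponential of the
  player's own gain, and \<open>m = l\<^sub>i\<close> gives regret \<open>O(ln n)\<close> against action \<open>i\<close>. Here \<open>\<eta> = 1 / 20\<close>.\<close>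

section \<open>Potential weights and the perturbed Hedge strategy\<close>

definition weight :: "(nat \<Rightarrow> real) \<Rightarrow> (nat \<Rightarrow> real) \<Rightarrow> real \<Rightarrow> nat \<Rightarrow> real" where
  "weight G l m i = exp (G i / 20 - (l i - m)\<^sup>2 / 400)"

lemma weight_pos [simp]: "0 < weight G l m i"
  by (simp add: weight_def)

lemma sum_weight_pos: "1 \<le> n \<Longrightarrow> 0 < (\<Sum>i<n. weight G l m i)"
  by (intro sum_pos) (auto simp: lessThan_empty_iff)

text \<open>At \<open>m = -1\<close> every summand is nonnegative and at \<open>m = 1\<close> every
  summand is nonpositive, so continuity in \<open>m\<close> gives a root. Since the weights are
  positive and themselves depend on \<open>m\<close>, a root is a fixed point of the weighted-mean
  map.\<close>

lemma center_exists:
  assumes "\<And>i. i < n \<Longrightarrow> \<bar>l i\<bar> \<le> 1"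
  shows "\<exists>m. -1 \<le> m \<and> m \<le> 1 \<and> (\<Sum>i<n. weight G l m i * (l i - m)) = 0"
proof (rule IVT2)
  show "(\<Sum>i<n. weight G l 1 i * (l i - 1)) \<le> 0"
    using assms by (intro sum_nonpos mult_nonneg_nonpos) (auto simp: abs_le_iff less_imp_le)
  show "0 \<le> (\<Sum>i<n. weight G l (-1) i * (l i - (-1)))"
    using assms by (intro sum_nonneg mult_nonneg_nonneg) (force simp: abs_le_iff less_imp_le)+
qed (auto simp: weight_def intro!: continuous_intros)

definition center :: "nat \<Rightarrow> (nat \<Rightarrow> real) \<Rightarrow> (nat \<Rightarrow> real) \<Rightarrow> real" where
  "center n G l = (SOME m. -1 \<le> m \<and> m \<le> 1 \<and> (\<Sum>i<n. weight G l m i * (l i - m)) = 0)"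

lemma center:
  assumes "\<And>i. i < n \<Longrightarrow> \<bar>l i\<bar> \<le> 1"
  shows "-1 \<le> center n G l" "center n G l \<le> 1"
    "(\<Sum>i<n. weight G l (center n G l) i * (l i - center n G l)) = 0"
  using someI_ex[OF center_exists[OF assms, where G = G]] unfolding center_def by auto

text \<open>The factor is \<open>1 - 4 * \<eta> * (l i - m)\<close> with \<eta> = 1/20. The term
  with 4\<eta> is the first-order response of the quadratic penalty to a gain increment, relative to
  that of the exponential gain.\<close>

definition strategy :: "nat \<Rightarrow> (nat \<Rightarrow> real) \<Rightarrow> (nat \<Rightarrow> real) \<Rightarrow> nat \<Rightarrow> real" where
  "strategy n G l i = (let m = center n G l in
     weight G l m i * (1 - (l i - m) / 5) / (\<Sum>j<n. weight G l m j))"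

lemma strategy_nonneg:
  assumes "\<And>i. i < n \<Longrightarrow> \<bar>l i\<bar> \<le> 1" "i < n"
  shows "0 \<le> strategy n G l i"
  unfolding strategy_def Let_def
  using center(1,2)[of n l G, OF assms(1)] assms(1)[OF assms(2)]
  by (intro divide_nonneg_nonneg mult_nonneg_nonneg sum_nonneg) (auto simp: less_imp_le abs_le_iff field_simps)

text \<open>The perturbation contributes a multiple of the weighted sum of \<open>l i - m\<close>,
  which the fixed-point equation of the centre makes zero.\<close>

lemma sum_strategy:
  assumes "\<And>i. i < n \<Longrightarrow> \<bar>l i\<bar> \<le> 1" "1 \<le> n"
  shows "(\<Sum>i<n. strategy n G l i) = 1"
proof -
  define m where "m = center n G l"
  have "(\<Sum>i<n. weight G l m i * (1 - (l i - m) / 5)) =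
      (\<Sum>i<n. weight G l m i) - (\<Sum>i<n. weight G l m i * (l i - m)) / 5"
    by (simp add: algebra_simps sum_subtractf sum_divide_distrib diff_divide_distrib add_divide_distrib sum.distrib)
  then have "(\<Sum>i<n. weight G l m i * (1 - (l i - m) / 5)) = (\<Sum>i<n. weight G l m i)"
    using center(3)[OF assms(1), where G = G] by (simp add: m_def)
  then show ?thesis
    using sum_weight_pos[OF assms(2), of G l m]
    by (simp add: strategy_def Let_def m_def flip: sum_divide_distrib)
qed

section \<open>One-step bound on the potential\<close>

text \<open>This is ln (1 + z) \<ge> z - 2 z^2 after exponentiation. The penalty \<open>q\<close>
  pays for the second-order error, leaving an expression linear in \<open>z\<close> that can be
  summed over actions.\<close>

lemma exp_quadratic_le_one_plus:
  fixes z :: real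
  assumes "\<bar>z\<bar> \<le> 1 / 2" "2 * z\<^sup>2 \<le> q"
  shows "exp (z - q) \<le> 1 + z"
proof -
  have "z - q \<le> ln (1 + z)"
    using abs_ln_one_plus_x_minus_x_bound[OF assms(1)] assms(2) by (simp add: abs_le_iff)
  then have "exp (z - q) \<le> exp (ln (1 + z))" by simp
  also have "\<dots> = 1 + z" using assms(1) by (simp add: abs_le_iff)
  finally show ?thesis .
qed

text \<open>The bound holds for every \<open>m'\<close>, so the centre of the next round need not be related to the
  present one.\<close>

lemma sum_weight_step:
  assumes n: "1 \<le> n"
    and l: "\<And>i. i < n \<Longrightarrow> \<bar>l i\<bar> \<le> 1" and l': "\<And>i. i < n \<Longrightarrow> \<bar>l' i\<bar> \<le> 1"
    and m': "\<bar>m'\<bar> \<le> 1"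
  shows "(\<Sum>i<n. weight (\<lambda>i. G i - (l i + l' i) / 2) l' m' i) \<le>
    (\<Sum>i<n. weight G l (center n G l) i) * exp (- (\<Sum>i<n. strategy n G l i * (l i + l' i)) / 40)"
proof -
  define m where "m = center n G l"
  define a where "a = weight G l m"
  define S where "S = (\<Sum>i<n. a i)"
  \<comment> \<open>The gain increment, recentred so that
    \<open>l' i - m' = - (l i - m) - 2 * w i\<close>. The common shift \<open>(m + m') / 2\<close>
    is factored out of all weights.\<close>
  define w where "w i = (m + m') / 2 - (l i + l' i) / 2" for i
  define r where "r i = 1 - (l i - m) / 5" for i
  have m: "\<bar>m\<bar> \<le> 1" using center(1,2)[OF l, where G = G] by (auto simp: m_def abs_le_iff)
  have S: "0 < S" unfolding S_def a_def by (rule sum_weight_pos[OF n])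
  have strat: "a i * r i = S * strategy n G l i" for i
    using S by (simp add: strategy_def Let_def S_def a_def r_def m_def)
  have step: "weight (\<lambda>i. G i - (l i + l' i) / 2) l' m' i \<le>
      exp (- (m + m') / 40) * (a i * (1 + w i * r i / 20))" if i: "i < n" for i
  proof -
    have w: "\<bar>w i\<bar> \<le> 2" and r: "\<bar>r i\<bar> \<le> 7 / 5"
      using l[OF i] l'[OF i] m m' by (auto simp: w_def r_def abs_le_iff field_simps)
    have "\<bar>w i * r i\<bar> \<le> 2 * (7 / 5)"
      unfolding abs_mult using w r by (intro mult_mono) auto
    then have z: "\<bar>w i * r i / 20\<bar> \<le> 1 / 2" by simp
    \<comment> \<open>The choice \<eta> = 1/20 is small enough here: it gives
      \<open>(r i)^2 \<le> 49/25 \<le> 2\<close>, so twice the squared linear term is at most the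
      penalty drop \<open>(w i)^2 / 100\<close>.\<close>
    have "(r i)\<^sup>2 \<le> (7 / 5)\<^sup>2" using r by (simp flip: abs_le_square_iff)
    also have "\<dots> \<le> (2 :: real)" by (simp add: power2_eq_square)
    finally have "(w i)\<^sup>2 * (r i)\<^sup>2 \<le> (w i)\<^sup>2 * 2"
      by (rule mult_left_mono) simp
    then have q: "2 * (w i * r i / 20)\<^sup>2 \<le> (w i)\<^sup>2 / 100"
      by (simp add: power_mult_distrib power_divide mult.commute)
    \<comment> \<open>Expanding the new penalty through the recentred increment yields the old
      penalty, the drop \<open>(w i)^2 / 100\<close>, and a term linear in \<open>w i\<close>; the
      last one turns \<open>w i / 20\<close> into \<open>w i * r i / 20\<close>.\<close>
    have "G i / 20 - (l i + l' i) / 2 / 20 - (l' i - m')\<^sup>2 / 400 =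
        - (m + m') / 40 + (G i / 20 - (l i - m)\<^sup>2 / 400) + (w i * r i / 20 - (w i)\<^sup>2 / 100)"
      by (simp add: w_def r_def power2_eq_square field_simps)
    then have "weight (\<lambda>i. G i - (l i + l' i) / 2) l' m' i =
        exp (- (m + m') / 40) * (a i * exp (w i * r i / 20 - (w i)\<^sup>2 / 100))"
      by (simp add: weight_def a_def diff_divide_distrib mult.assoc flip: exp_add)
    also have "\<dots> \<le> exp (- (m + m') / 40) * (a i * (1 + w i * r i / 20))"
      using exp_quadratic_le_one_plus[OF z q] by (intro mult_left_mono) (auto simp: a_def less_imp_le)
    finally show ?thesis .
  qed
  define c where "c = (\<Sum>i<n. strategy n G l i * (l i + l' i))"
  have "(\<Sum>i<n. a i * (1 + w i * r i / 20)) = S + (\<Sum>i<n. a i * r i * w i) / 20"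
    by (simp add: S_def algebra_simps sum.distrib sum_divide_distrib)
  also have "(\<Sum>i<n. a i * r i * w i) = S * (\<Sum>i<n. strategy n G l i * w i)"
    by (simp add: strat sum_distrib_left mult.assoc)
  also have "(\<Sum>i<n. strategy n G l i * w i) = (m + m') / 2 * (\<Sum>i<n. strategy n G l i) - c / 2"
    by (simp add: w_def c_def sum_distrib_left sum_divide_distrib sum_subtractf[symmetric] algebra_simps)
  also have "(\<Sum>i<n. strategy n G l i) = 1" by (rule sum_strategy[OF l n])
  finally have eq: "(\<Sum>i<n. a i * (1 + w i * r i / 20)) = S * (1 + ((m + m') / 40 - c / 40))"
    by (simp add: field_simps)
  have "(\<Sum>i<n. weight (\<lambda>i. G i - (l i + l' i) / 2) l' m' i) \<le>
      exp (- (m + m') / 40) * (S * (1 + ((m + m') / 40 - c / 40)))"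
    unfolding eq[symmetric] sum_distrib_left by (intro sum_mono step) auto
  \<comment> \<open>Back in exponential form, the shift by \<open>m + m'\<close> cancels and only
    the player's own loss \<open>c\<close> remains.\<close>
  also have "\<dots> \<le> exp (- (m + m') / 40) * (S * exp ((m + m') / 40 - c / 40))"
    using S by (intro mult_left_mono exp_ge_add_one_self) auto
  also have "\<dots> = S * (exp (- (m + m') / 40) * exp ((m + m') / 40 - c / 40))" by simp
  also have "\<dots> = S * exp (- c / 40)"
    unfolding exp_add[symmetric] by (simp add: diff_divide_distrib add_divide_distrib)
  finally show ?thesis by (simp add: S_def a_def m_def c_def)
qed

section \<open>Regret against a single action\<close>

text \<open>Only \<open>l 0\<close> to \<open>l t\<close> enter, so the value is known before
  \<open>l (Suc t)\<close> is. When \<open>l 0 = 0\<close> and \<open>t \<ge> 1\<close>, it is minus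
  the cumulative loss with the last vector counted by half.\<close>

definition gains :: "(nat \<Rightarrow> nat \<Rightarrow> real) \<Rightarrow> nat \<Rightarrow> nat \<Rightarrow> real" where
  "gains l t i = - (\<Sum>s<t. (l s i + l (Suc s) i) / 2)"

text \<open>The potential starts at most \<open>n\<close>, and each round multiplies its bound by
  the exponential of minus the player's loss over 40. Comparing with the single weight of action
  \<open>j\<close> and taking logarithms gives the bound; 40 is 2/\<eta>.\<close>

lemma strategy_regret:
  fixes l :: "nat \<Rightarrow> nat \<Rightarrow> real"
  assumes n: "1 \<le> n" and l: "\<And>s i. i < n \<Longrightarrow> \<bar>l s i\<bar> \<le> 1" and l0: "\<And>i. l 0 i = 0"
    and j: "j < n"
  shows "(\<Sum>s<T. \<Sum>i<n. strategy n (gains l s) (l s) i * (l s i + l (Suc s) i))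
    \<le> (\<Sum>s<T. l s j + l (Suc s) j) + 40 * ln (real n)"
proof -
  define R where "R T = (\<Sum>s<T. \<Sum>i<n. strategy n (gains l s) (l s) i * (l s i + l (Suc s) i))" for T
  \<comment> \<open>Quantifying over all \<open>m\<close> lets the induction step use the hypothesis
    at the centre of round \<open>t\<close>, whatever \<open>m\<close> is asked for at
    \<open>Suc t\<close>.\<close>
  have inv: "(\<Sum>i<n. weight (gains l t) (l t) m i) \<le> real n * exp (- R t / 40)" if "\<bar>m\<bar> \<le> 1" for m t
    using that
  proof (induction t arbitrary: m)
    case 0
    have "(\<Sum>i<n. weight (gains l 0) (l 0) m i) \<le> (\<Sum>i<n. 1)"
      by (intro sum_mono) (auto simp: weight_def gains_def l0)
    then show ?case by (simp add: R_def)
  next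
    case (Suc t)
    let ?c = "center n (gains l t) (l t)"
    have c: "\<bar>?c\<bar> \<le> 1" using center(1,2)[of n "l t", OF l] by (auto simp: abs_le_iff)
    have g: "gains l (Suc t) = (\<lambda>i. gains l t i - (l t i + l (Suc t) i) / 2)"
      by (auto simp: gains_def)
    have "(\<Sum>i<n. weight (gains l (Suc t)) (l (Suc t)) m i) \<le> (\<Sum>i<n. weight (gains l t) (l t) ?c i) *
        exp (- (\<Sum>i<n. strategy n (gains l t) (l t) i * (l t i + l (Suc t) i)) / 40)"
      unfolding g using n Suc.prems by (intro sum_weight_step l) auto
    also have "\<dots> \<le> real n * exp (- R t / 40) *
        exp (- (\<Sum>i<n. strategy n (gains l t) (l t) i * (l t i + l (Suc t) i)) / 40)"
      using Suc.IH[OF c] by (intro mult_right_mono) auto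
    also have "\<dots> = real n * exp (- R (Suc t) / 40)"
      by (simp add: R_def mult.assoc diff_divide_distrib flip: exp_add)
    finally show ?case .
  qed
  \<comment> \<open>With \<open>m = l T j\<close> the penalty of action \<open>j\<close> vanishes,
    and its weight is the pure exponential of its gain.\<close>
  have "weight (gains l T) (l T) (l T j) j \<le> (\<Sum>i<n. weight (gains l T) (l T) (l T j) i)"
    using j by (intro member_le_sum) (auto simp: less_imp_le)
  also have "\<dots> \<le> real n * exp (- R T / 40)" using l[OF j] by (rule inv)
  also have "\<dots> = exp (ln (real n) + - R T / 40)" using n by (simp only: exp_add) simp
  finally have "exp (gains l T j / 20) \<le> exp (ln (real n) + - R T / 40)" by (simp add: weight_def)
  then have "gains l T j / 20 \<le> ln (real n) - R T / 40" by simp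
  then show ?thesis
    by (simp add: R_def gains_def flip: sum_divide_distrib)
qed

section \<open>The online algorithm and linear losses\<close>

text \<open>Clipping makes \<open>hedge\<close> return a mixed strategy on arbitrary observations. Round 0 is a
  fictitious round without losses.\<close>

definition coord_loss :: "nat \<Rightarrow> (nat \<Rightarrow> real vec \<Rightarrow> real) \<Rightarrow> nat \<Rightarrow> nat \<Rightarrow> real" where
  "coord_loss n F s i = (if s = 0 then 0 else max (-1) (min 1 (F s (unit_vec n i))))"

text \<open>The list counts from 0, so round \<open>s\<close> sits at position \<open>s - 1\<close>.
  After \<open>t\<close> observations \<open>l t\<close> is the newest loss vector, the half of the
  next charge that is already known.\<close>

definition hedge :: algorithm where
  "hedge n fs = (let l = coord_loss n (\<lambda>s. fs ! (s - 1)); t = length fs in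
     vec n (strategy n (gains l t) (l t)))"

lemma abs_coord_loss_le: "\<bar>coord_loss n F s i\<bar> \<le> 1"
  by (auto simp: coord_loss_def)

lemma online_algorithm_hedge: "online_algorithm hedge"
  unfolding online_algorithm_def
  by (auto simp: hedge_def Let_def prob_simplex_def sum_strategy strategy_nonneg abs_coord_loss_le)

text \<open>Only rounds up to \<open>t\<close> enter the strategy, so the observed list can be
  replaced by the infinite sequence it is a prefix of, the same one for all
  \<open>t\<close>.\<close>

lemma hedge_map:
  "hedge n (map F [1..<Suc t]) = vec n (strategy n (gains (coord_loss n F) t) (coord_loss n F t))"
proof -
  have eq: "coord_loss n (\<lambda>s. map F [1..<Suc t] ! (s - 1)) s = coord_loss n F s" if "s \<le> t" for s
    using that by (auto simp: coord_loss_def fun_eq_iff simp del: upt_Suc One_nat_def)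
  have "gains (coord_loss n (\<lambda>s. map F [1..<Suc t] ! (s - 1))) t = gains (coord_loss n F) t"
    unfolding gains_def fun_eq_iff by (auto intro!: sum.cong simp: eq simp del: upt_Suc One_nat_def)
  then show ?thesis
    by (simp add: hedge_def Let_def eq del: upt_Suc One_nat_def)
qed

lemma unit_vec_in_prob_simplex: "i < n \<Longrightarrow> unit_vec n i \<in> prob_simplex n"
  by (auto simp: prob_simplex_def unit_vec_def)

text \<open>Linearity is phrased through the vertices because an observed loss carries information
  on the simplex only.\<close>

definition linear_on_simplex :: "nat \<Rightarrow> (real vec \<Rightarrow> real) \<Rightarrow> bool" where
  "linear_on_simplex n f \<longleftrightarrow> (\<forall>x\<in>prob_simplex n. f x = (\<Sum>i<n. x $ i * f (unit_vec n i)) \<and> \<bar>f x\<bar> \<le> 1)"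

text \<open>For \<open>n = 1\<close> the right-hand side is 0. This bounds boundary terms of the regret, so that no
  additive constant survives.\<close>

lemma linear_on_simplex_diff_le:
  assumes "linear_on_simplex n f" "x \<in> prob_simplex n" "y \<in> prob_simplex n" "1 \<le> n"
  shows "f x - f y \<le> 4 * ln (real n)"
proof (cases "n = 1")
  case True
  with assms(2,3) have "x = y" by (auto simp: prob_simplex_def)
  with True show ?thesis by simp
next
  case False
  with assms(4) have "ln 2 \<le> ln (real n)" by simp
  \<comment> \<open>The difference is at most 2, and 2 \<le> 4 ln 2; hence the constant 4.\<close>
  moreover have "1 / 2 \<le> ln (2::real)" using ln_2_less_1 ln2_ge_two_thirds by simp
  moreover have "\<bar>f x\<bar> \<le> 1" "\<bar>f y\<bar> \<le> 1" using assms unfolding linear_on_simplex_def by auto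
  ultimately show ?thesis by (simp add: abs_le_iff)
qed

section \<open>Regret against mixed strategies in the two roles\<close>

text \<open>The strategy chosen after \<open>s\<close> observations is charged for rounds
  \<open>s\<close> and \<open>Suc s\<close>. By linearity the regret against \<open>u\<close> is the
  \<open>u\<close>-average of the regrets against single actions.\<close>

lemma hedge_regret:
  fixes F :: "nat \<Rightarrow> real vec \<Rightarrow> real" and n :: nat
  defines "z t \<equiv> hedge n (map F [1..<Suc t])"
  assumes n: "1 \<le> n" and F: "\<And>s. 1 \<le> s \<Longrightarrow> linear_on_simplex n (F s)"
    and u: "u \<in> prob_simplex n"
  shows "(\<Sum>s<T. F (Suc s) (z s)) + (\<Sum>s=1..<T. F s (z s))
    \<le> (\<Sum>s<T. F (Suc s) u) + (\<Sum>s=1..<T. F s u) + 40 * ln (real n)"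
proof -
  define l where "l = coord_loss n F"
  have F_eq: "F s x = (\<Sum>i<n. x $ i * l s i)" if "1 \<le> s" "x \<in> prob_simplex n" for s x
  proof -
    \<comment> \<open>Clipping has no effect here, as the losses are bounded by 1 on the
      vertices.\<close>
    have "l s i = F s (unit_vec n i)" if "i < n" for i
      using F[OF \<open>1 \<le> s\<close>] \<open>1 \<le> s\<close> unit_vec_in_prob_simplex[OF that]
      unfolding linear_on_simplex_def l_def coord_loss_def by (auto simp: abs_le_iff)
    then show ?thesis
      using F[OF that(1)] that(2) unfolding linear_on_simplex_def by simp
  qed
  have split: "(\<Sum>s<T. \<Sum>i<n. x s $ i * (l s i + l (Suc s) i)) =
      (\<Sum>s<T. F (Suc s) (x s)) + (\<Sum>s=1..<T. F s (x s))" if "\<And>s. x s \<in> prob_simplex n" for x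
  proof -
    \<comment> \<open>The fictitious round 0 contributes nothing, so the second sum may start at
      1.\<close>
    have "(\<Sum>s<T. \<Sum>i<n. x s $ i * l s i) = (\<Sum>s=1..<T. \<Sum>i<n. x s $ i * l s i)"
      by (rule sum.mono_neutral_right) (auto simp: l_def coord_loss_def)
    then show ?thesis
      using that by (simp add: F_eq distrib_left sum.distrib)
  qed
  have z: "z t \<in> prob_simplex n" for t
    using online_algorithm_hedge n unfolding online_algorithm_def z_def by blast
  have zi: "z t $ i = strategy n (gains l t) (l t) i" if "i < n" for t i
    using that by (simp add: z_def hedge_map l_def del: upt_Suc One_nat_def)
  have u': "\<And>i. i < n \<Longrightarrow> 0 \<le> u $ i" "(\<Sum>i<n. u $ i) = 1" using u by (auto simp: prob_simplex_def)
  let ?R = "\<Sum>s<T. \<Sum>i<n. z s $ i * (l s i + l (Suc s) i)"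
  have R: "?R \<le> (\<Sum>s<T. l s j + l (Suc s) j) + 40 * ln (real n)" if "j < n" for j
  proof -
    have "?R = (\<Sum>s<T. \<Sum>i<n. strategy n (gains l s) (l s) i * (l s i + l (Suc s) i))" by (simp add: zi)
    also have "\<dots> \<le> (\<Sum>s<T. l s j + l (Suc s) j) + 40 * ln (real n)"
      by (rule strategy_regret) (use n that in \<open>auto simp: l_def abs_coord_loss_le coord_loss_def\<close>)
    finally show ?thesis .
  qed
  have "?R = (\<Sum>j<n. u $ j * ?R)" using u' by (simp flip: sum_distrib_right)
  also have "\<dots> \<le> (\<Sum>j<n. u $ j * ((\<Sum>s<T. l s j + l (Suc s) j) + 40 * ln (real n)))"
    by (intro sum_mono mult_left_mono R u') auto
  also have "\<dots> = (\<Sum>j<n. \<Sum>s<T. u $ j * (l s j + l (Suc s) j)) + 40 * ln (real n)"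
    using u'(2) by (simp add: distrib_left sum.distrib sum_distrib_left flip: sum_distrib_right)
  also have "(\<Sum>j<n. \<Sum>s<T. u $ j * (l s j + l (Suc s) j)) = (\<Sum>s<T. \<Sum>j<n. u $ j * (l s j + l (Suc s) j))"
    by (rule sum.swap)
  finally show ?thesis using split[of z, OF z] split[of "\<lambda>_. u", OF u] by simp
qed

text \<open>For the player who moves first. Over \<open>T\<close> charges
  \<open>hedge_regret\<close> covers every term except round \<open>T\<close> at
  \<open>x (Suc T)\<close>; adding this boundary term costs \<open>4 * ln n\<close>.\<close>

lemma hedge_regret_leading:
  assumes n: "1 \<le> n" and T: "1 \<le> T" and F: "\<And>s. 1 \<le> s \<Longrightarrow> linear_on_simplex n (F s)"
    and u: "u \<in> prob_simplex n" and x: "\<And>t. x (Suc t) = hedge n (map F [1..<Suc t])"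
  shows "(\<Sum>t=1..T. F t (x t) + F t (x (Suc t))) \<le> 2 * (\<Sum>t=1..T. F t u) + 44 * ln (real n)"
proof -
  obtain k where k: "T = Suc k" using T by (cases T) auto
  have "x (Suc T) \<in> prob_simplex n"
    using online_algorithm_hedge n unfolding online_algorithm_def x by blast
  then have "F T (x (Suc T)) - F T u \<le> 4 * ln (real n)"
    using n u F[OF T] by (intro linear_on_simplex_diff_le)
  moreover have "(\<Sum>s<T. F (Suc s) (x (Suc s))) + (\<Sum>s=1..<T. F s (x (Suc s)))
    \<le> (\<Sum>s<T. F (Suc s) u) + (\<Sum>s=1..<T. F s u) + 40 * ln (real n)"
    unfolding x by (rule hedge_regret[OF n F u])
  moreover have shift: "(\<Sum>s<T. f (Suc s)) = (\<Sum>t=1..T. f t)" for f :: "nat \<Rightarrow> real"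
    by (simp add: sum.atLeast1_atMost_eq)
  note shift[of "\<lambda>t. F t (x t)"] shift[of "\<lambda>t. F t u"]
  moreover have last: "(\<Sum>t=1..T. f t) = (\<Sum>s=1..<T. f s) + f T" for f :: "nat \<Rightarrow> real"
    unfolding k by (simp add: atLeastLessThanSuc_atLeastAtMost)
  note last[of "\<lambda>t. F t (x (Suc t))"] last[of "\<lambda>t. F t u"]
  ultimately show ?thesis unfolding sum.distrib by linarith
qed

text \<open>For the player who moves second. Over \<open>Suc T\<close> charges
  \<open>hedge_regret\<close> also contains round 1 at \<open>y 0\<close>, the choice made before
  any observation; removing it costs \<open>4 * ln n\<close>.\<close>

lemma hedge_regret_following:
  assumes n: "1 \<le> n" and F: "\<And>s. 1 \<le> s \<Longrightarrow> linear_on_simplex n (F s)"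
    and u: "u \<in> prob_simplex n" and y: "\<And>t. y t = hedge n (map F [1..<Suc t])"
  shows "(\<Sum>t=1..T. F t (y t) + F (Suc t) (y t)) \<le> (\<Sum>t=1..T. F t u + F (Suc t) u) + 44 * ln (real n)"
proof -
  have "y 0 \<in> prob_simplex n"
    using online_algorithm_hedge n unfolding online_algorithm_def y by blast
  then have "F 1 u - F 1 (y 0) \<le> 4 * ln (real n)"
    using n u F by (intro linear_on_simplex_diff_le) auto
  moreover have "(\<Sum>s<Suc T. F (Suc s) (y s)) + (\<Sum>s=1..<Suc T. F s (y s))
    \<le> (\<Sum>s<Suc T. F (Suc s) u) + (\<Sum>s=1..<Suc T. F s u) + 40 * ln (real n)"
    unfolding y by (rule hedge_regret[OF n F u])
  moreover have "(\<Sum>s<Suc T. f s) = f 0 + (\<Sum>t=1..T. f t)" for f :: "nat \<Rightarrow> real"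
    unfolding sum.lessThan_Suc_shift by (simp add: sum.atLeast1_atMost_eq)
  ultimately show ?thesis
    by (simp add: sum.distrib atLeastLessThanSuc_atLeastAtMost del: sum.lessThan_Suc)
qed

section \<open>Bilinearity of the loss and averaged strategies\<close>

lemma loss_eq_sum:
  assumes "M \<in> carrier_mat d1 d2" "x \<in> carrier_vec d1" "y \<in> carrier_vec d2"
  shows "loss M x y = (\<Sum>i<d1. \<Sum>j<d2. x $ i * M $$ (i, j) * y $ j)"
  using assms by (auto simp: loss_def scalar_prod_def sum_distrib_left mult.assoc atLeast0LessThan
      intro!: sum.cong)

lemma prob_simplex_carrier: "x \<in> prob_simplex n \<Longrightarrow> x \<in> carrier_vec n"
  by (simp add: prob_simplex_def)

lemma loss_left_expand:
  assumes "M \<in> carrier_mat d1 d2" "x \<in> carrier_vec d1" "y \<in> carrier_vec d2"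
  shows "loss M x y = (\<Sum>i<d1. x $ i * loss M (unit_vec d1 i) y)"
proof -
  have "loss M (unit_vec d1 i) y = (M *\<^sub>v y) $ i" if "i < d1" for i
    using assms that by (simp add: loss_def)
  then show ?thesis
    using assms by (simp add: loss_def scalar_prod_def atLeast0LessThan)
qed

lemma loss_right_expand:
  assumes "M \<in> carrier_mat d1 d2" "x \<in> carrier_vec d1" "y \<in> carrier_vec d2"
  shows "loss M x y = (\<Sum>j<d2. y $ j * loss M x (unit_vec d2 j))"
proof -
  have "loss M x (unit_vec d2 j) = (\<Sum>i<d1. x $ i * M $$ (i, j))" if "j < d2" for j
    using assms that
    by (simp add: loss_def scalar_prod_def atLeast0LessThan if_distrib[of "(*) _"] cong: if_cong)
  then have "(\<Sum>j<d2. y $ j * loss M x (unit_vec d2 j)) = (\<Sum>j<d2. \<Sum>i<d1. x $ i * M $$ (i, j) * y $ j)"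
    by (simp add: sum_distrib_left mult_ac)
  also have "\<dots> = loss M x y" unfolding loss_eq_sum[OF assms] by (rule sum.swap)
  finally show ?thesis by simp
qed

lemma average_in_prob_simplex:
  assumes "1 \<le> T" "\<And>t. 1 \<le> t \<Longrightarrow> x t \<in> prob_simplex n"
  shows "average n T x \<in> prob_simplex n"
proof -
  have "(\<Sum>i<n. \<Sum>t=1..T. x t $ i) = (\<Sum>t=1..T. \<Sum>i<n. x t $ i)" by (rule sum.swap)
  also have "\<dots> = real T" using assms(2) by (simp add: prob_simplex_def)
  finally show ?thesis
    using assms by (auto simp: prob_simplex_def average_def sum_divide_distrib[symmetric]
        intro!: divide_nonneg_nonneg sum_nonneg)
qed

lemma loss_average_left:
  assumes "M \<in> carrier_mat d1 d2" "\<And>t. 1 \<le> t \<Longrightarrow> x t \<in> carrier_vec d1" "y \<in> carrier_vec d2"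
  shows "loss M (average d1 T x) y = (\<Sum>t=1..T. loss M (x t) y) / real T"
proof -
  have "loss M (average d1 T x) y = (\<Sum>i<d1. average d1 T x $ i * loss M (unit_vec d1 i) y)"
    using assms by (intro loss_left_expand) (auto simp: average_def)
  also have "\<dots> = (\<Sum>i<d1. \<Sum>t=1..T. x t $ i * loss M (unit_vec d1 i) y) / real T"
    by (simp add: average_def sum_distrib_right sum_divide_distrib)
  also have "(\<Sum>i<d1. \<Sum>t=1..T. x t $ i * loss M (unit_vec d1 i) y) = (\<Sum>t=1..T. loss M (x t) y)"
    using assms by (subst sum.swap) (simp add: loss_left_expand[of M d1 d2])
  finally show ?thesis .
qed

lemma loss_average_right:
  assumes "M \<in> carrier_mat d1 d2" "x \<in> carrier_vec d1" "\<And>t. 1 \<le> t \<Longrightarrow> y t \<in> carrier_vec d2"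
  shows "loss M x (average d2 T y) = (\<Sum>t=1..T. loss M x (y t)) / real T"
proof -
  have "loss M x (average d2 T y) = (\<Sum>j<d2. average d2 T y $ j * loss M x (unit_vec d2 j))"
    using assms by (intro loss_right_expand) (auto simp: average_def)
  also have "\<dots> = (\<Sum>j<d2. \<Sum>t=1..T. y t $ j * loss M x (unit_vec d2 j)) / real T"
    by (simp add: average_def sum_distrib_right sum_divide_distrib)
  also have "(\<Sum>j<d2. \<Sum>t=1..T. y t $ j * loss M x (unit_vec d2 j)) = (\<Sum>t=1..T. loss M x (y t))"
    using assms by (subst sum.swap) (simp add: loss_right_expand[of M d1 d2])
  finally show ?thesis .
qed

section \<open>Expectation under the uniform distribution on a multiset\<close>

text \<open>A fixed superset \<open>S\<close> of the support keeps the index set unchanged while the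
  induction adds elements to \<open>M\<close>.\<close>

lemma sum_count_mult:
  fixes f :: "'a \<Rightarrow> real"
  assumes "finite S" "set_mset M \<subseteq> S"
  shows "(\<Sum>x\<in>S. real (count M x) * f x) = (\<Sum>x\<in>#M. f x)"
  using assms(2)
proof (induction M)
  case (add a M)
  have "(\<Sum>x\<in>S. real (count (add_mset a M) x) * f x) =
      (\<Sum>x\<in>S. (if x = a then f x else 0) + real (count M x) * f x)"
    by (intro sum.cong) (auto simp: algebra_simps)
  also have "\<dots> = f a + (\<Sum>x\<in>#M. f x)"
    using add assms(1) by (simp add: sum.distrib)
  finally show ?case by simp
qed simp

lemma expectation_pmf_of_multiset:
  fixes f :: "'a \<Rightarrow> real"
  assumes "M \<noteq> {#}"
  shows "measure_pmf.expectation (pmf_of_multiset M) f = (\<Sum>x\<in>#M. f x) / real (size M)"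
proof -
  have "measure_pmf.expectation (pmf_of_multiset M) f = (\<Sum>x\<in>set_mset M. f x * pmf (pmf_of_multiset M) x)"
    using assms by (intro integral_measure_pmf_real) auto
  also have "\<dots> = (\<Sum>x\<in>set_mset M. real (count M x) * f x) / real (size M)"
    using assms by (simp add: sum_divide_distrib mult.commute)
  also have "(\<Sum>x\<in>set_mset M. real (count M x) * f x) = (\<Sum>x\<in>#M. f x)"
    by (rule sum_count_mult) auto
  finally show ?thesis .
qed

lemma alternating_profiles_Suc:
  "alternating_profiles (Suc T) x y =
    alternating_profiles T x y + {#(x (Suc T), y (Suc T)), (x (Suc (Suc T)), y (Suc T))#}"
  by (simp add: alternating_profiles_def)

lemma size_alternating_profiles: "size (alternating_profiles T x y) = 2 * T"
  by (induction T) (auto simp: alternating_profiles_Suc, simp add: alternating_profiles_def)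

lemma sum_alternating_profiles:
  fixes f :: "real vec \<times> real vec \<Rightarrow> real"
  shows "(\<Sum>p\<in>#alternating_profiles T x y. f p) = (\<Sum>t=1..T. f (x t, y t) + f (x (Suc t), y t))"
  by (induction T) (auto simp: alternating_profiles_Suc, simp add: alternating_profiles_def)

lemma set_alternating_profiles:
  "set_mset (alternating_profiles T x y) = (\<Union>t\<in>{1..T}. {(x t, y t), (x (Suc t), y t)})"
  by (induction T) (auto simp: alternating_profiles_Suc atLeastAtMostSuc_conv, simp add: alternating_profiles_def)

lemma expectation_alternating_profiles:
  fixes f :: "real vec \<Rightarrow> real vec \<Rightarrow> real"
  assumes "1 \<le> T"
  shows "measure_pmf.expectation (pmf_of_multiset (alternating_profiles T x y)) (\<lambda>(x, y). f x y) =
    (\<Sum>t=1..T. f (x t) (y t) + f (x (Suc t)) (y t)) / (2 * real T)"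
proof -
  have "alternating_profiles T x y \<noteq> {#}"
    using size_alternating_profiles[of T x y] assms by auto
  then show ?thesis
    by (simp add: expectation_pmf_of_multiset size_alternating_profiles sum_alternating_profiles)
qed

section \<open>Regret along the alternating play\<close>

lemma linear_loss_left:
  assumes "normal_form_game d1 d2 A B" "y \<in> prob_simplex d2"
  shows "linear_on_simplex d1 (\<lambda>x\<in>prob_simplex d1. loss A x y)"
proof -
  let ?f = "\<lambda>x\<in>prob_simplex d1. loss A x y"
  have "?f x = (\<Sum>i<d1. x $ i * ?f (unit_vec d1 i))" if "x \<in> prob_simplex d1" for x
    using loss_left_expand[of A d1 d2 x y] assms that
    by (simp add: normal_form_game_def prob_simplex_carrier unit_vec_in_prob_simplex)
  moreover have "\<bar>?f x\<bar> \<le> 1" if "x \<in> prob_simplex d1" for x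
    using assms that by (auto simp: normal_form_game_def abs_le_iff minus_le_iff)
  ultimately show ?thesis unfolding linear_on_simplex_def by blast
qed

lemma linear_loss_right:
  assumes "normal_form_game d1 d2 A B" "x \<in> prob_simplex d1"
  shows "linear_on_simplex d2 (\<lambda>y\<in>prob_simplex d2. loss B x y)"
proof -
  let ?f = "\<lambda>y\<in>prob_simplex d2. loss B x y"
  have "?f y = (\<Sum>j<d2. y $ j * ?f (unit_vec d2 j))" if "y \<in> prob_simplex d2" for y
    using loss_right_expand[of B d1 d2 x y] assms that
    by (simp add: normal_form_game_def prob_simplex_carrier unit_vec_in_prob_simplex)
  moreover have "\<bar>?f y\<bar> \<le> 1" if "y \<in> prob_simplex d2" for y
    using assms that by (auto simp: normal_form_game_def abs_le_iff minus_le_iff)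
  ultimately show ?thesis unfolding linear_on_simplex_def by blast
qed

context
  fixes d1 d2 :: nat and A B :: "real mat" and x y :: "nat \<Rightarrow> real vec"
  assumes game: "normal_form_game d1 d2 A B"
    and x: "x = play_x hedge hedge d1 d2 A B" and y: "y = play_y hedge hedge d1 d2 A B"
begin

lemma play_in_prob_simplex: "x t \<in> prob_simplex d1" "y t \<in> prob_simplex d2"
  using online_algorithm_hedge game
  unfolding x y play_x.simps[of _ _ _ _ _ _ t] play_y.simps[of _ _ _ _ _ _ t]
    online_algorithm_def normal_form_game_def by blast+

lemma play_x_regret:
  assumes T: "1 \<le> T" and u: "u \<in> prob_simplex d1"
  shows "(\<Sum>t=1..T. loss A (x t) (y t) + loss A (x (Suc t)) (y t)) \<le>
    2 * (\<Sum>t=1..T. loss A u (y t)) + 44 * ln (real d1)"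
proof -
  let ?F = "\<lambda>s. \<lambda>x\<in>prob_simplex d1. loss A x (y s)"
  have lin: "linear_on_simplex d1 (?F s)" for s
    by (rule linear_loss_left[OF game play_in_prob_simplex(2)])
  \<comment> \<open>When \<open>x (Suc t)\<close> is chosen, rounds 1 to \<open>t\<close> have been
    seen: the leading role.\<close>
  have play_x_eq: "x (Suc t) = hedge d1 (map ?F [1..<Suc t])" for t
    unfolding x y by (rule play_x.simps)
  have "(\<Sum>t=1..T. ?F t (x t) + ?F t (x (Suc t))) \<le> 2 * (\<Sum>t=1..T. ?F t u) + 44 * ln (real d1)"
    using game lin T u play_x_eq by (intro hedge_regret_leading) (simp_all only: normal_form_game_def)
  then show ?thesis by (simp add: play_in_prob_simplex u)
qed

lemma play_y_regret:
  assumes u: "u \<in> prob_simplex d2"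
  shows "(\<Sum>t=1..T. loss B (x t) (y t) + loss B (x (Suc t)) (y t)) \<le>
    (\<Sum>t=1..T. loss B (x t) u + loss B (x (Suc t)) u) + 44 * ln (real d2)"
proof -
  let ?F = "\<lambda>s. \<lambda>y\<in>prob_simplex d2. loss B (x s) y"
  have lin: "linear_on_simplex d2 (?F s)" for s
    by (rule linear_loss_right[OF game play_in_prob_simplex(1)])
  \<comment> \<open>When \<open>y t\<close> is chosen, round \<open>t\<close> has already been seen:
    the following role.\<close>
  have play_y_eq: "y t = hedge d2 (map ?F [1..<Suc t])" for t
    unfolding x y by (rule play_y.simps)
  have "(\<Sum>t=1..T. ?F t (y t) + ?F (Suc t) (y t)) \<le>
      (\<Sum>t=1..T. ?F t u + ?F (Suc t) u) + 44 * ln (real d2)"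
    using game lin u play_y_eq by (intro hedge_regret_following) (simp_all only: normal_form_game_def)
  then show ?thesis by (simp add: play_in_prob_simplex u)
qed

section \<open>Approximate equilibria\<close>

text \<open>The expectations are the two regret sums divided by \<open>2 * T\<close>, so each
  condition is one player's regret bound.\<close>

lemma play_coarse_correlated_equilibrium:
  assumes T: "1 \<le> T" and d: "d1 \<le> d" "d2 \<le> d"
  shows "coarse_correlated_equilibrium d1 d2 A B (46 * ln (real d) / real T)
    (pmf_of_multiset (alternating_profiles T x y))"
proof -
  have pos: "1 \<le> d1" "1 \<le> d2" using game by (auto simp: normal_form_game_def)
  have ln: "ln (real d1) \<le> ln (real d)" "ln (real d2) \<le> ln (real d)" "0 \<le> ln (real d)"
    using pos d by auto
  \<comment> \<open>Division by \<open>2 * T\<close> would already give 22; 46 is the constant of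
    the zero-sum case.\<close>
  have le: "a / (2 * real T) \<le> b / (2 * real T) + 46 * ln (real d) / real T"
    if "a \<le> b + 44 * ln (real d)" for a b
    using that T ln(3) by (simp add: field_simps)
  have ne: "alternating_profiles T x y \<noteq> {#}"
    using size_alternating_profiles[of T x y] T by auto
  show ?thesis
    unfolding coarse_correlated_equilibrium_def
  proof (intro conjI ballI)
    show "set_pmf (pmf_of_multiset (alternating_profiles T x y)) \<subseteq> prob_simplex d1 \<times> prob_simplex d2"
      using play_in_prob_simplex by (auto simp: ne set_alternating_profiles)
  next
    fix x' assume "x' \<in> prob_simplex d1"
    from play_x_regret[OF T this] ln(1) show
      "measure_pmf.expectation (pmf_of_multiset (alternating_profiles T x y)) (\<lambda>(x, y). loss A x y) \<le>
       measure_pmf.expectation (pmf_of_multiset (alternating_profiles T x y)) (\<lambda>(x, y). loss A x' y) +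
         46 * ln (real d) / real T"
      unfolding expectation_alternating_profiles[OF T] by (intro le) (simp add: sum.distrib flip: sum_distrib_left)
  next
    fix y' assume "y' \<in> prob_simplex d2"
    from play_y_regret[OF this, of T] ln(2) show
      "measure_pmf.expectation (pmf_of_multiset (alternating_profiles T x y)) (\<lambda>(x, y). loss B x y) \<le>
       measure_pmf.expectation (pmf_of_multiset (alternating_profiles T x y)) (\<lambda>(x, y). loss B x y') +
         46 * ln (real d) / real T"
      unfolding expectation_alternating_profiles[OF T] by (intro le) simp
  qed
qed

text \<open>In a zero-sum game the realised losses \<open>?S\<close> cancel when the two regret
  bounds are added. This bounds the duality gap of the averages, which yields both Nash
  conditions.\<close>

lemma play_nash_equilibrium:
  assumes T: "1 \<le> T" and d: "d1 \<le> d" "d2 \<le> d" and zero_sum: "zero_sum A B"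
  shows "nash_equilibrium d1 d2 A B (46 * ln (real d) / real T) (average d1 T x, average d2 T y)"
proof -
  have pos: "1 \<le> d1" "1 \<le> d2" and A: "A \<in> carrier_mat d1 d2" and B: "B \<in> carrier_mat d1 d2"
    using game by (auto simp: normal_form_game_def)
  have ln: "ln (real d1) \<le> ln (real d)" "ln (real d2) \<le> ln (real d)"
    using pos d by auto
  have loss_B: "loss B u v = - loss A u v" if "u \<in> prob_simplex d1" "v \<in> prob_simplex d2" for u v
    using that zero_sum A B unfolding zero_sum_def
    by (simp add: loss_eq_sum[of _ d1 d2] prob_simplex_carrier sum_negf)
  let ?x = "average d1 T x" and ?y = "average d2 T y"
  have avg: "?x \<in> prob_simplex d1" "?y \<in> prob_simplex d2"
    using T play_in_prob_simplex by (auto intro: average_in_prob_simplex)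
  have gap: "loss A ?x v \<le> loss A u ?y + 46 * ln (real d) / real T"
    if u: "u \<in> prob_simplex d1" and v: "v \<in> prob_simplex d2" for u v
  proof -
    let ?S = "\<Sum>t=1..T. loss A (x t) (y t) + loss A (x (Suc t)) (y t)"
    have 1: "?S \<le> 2 * (\<Sum>t=1..T. loss A u (y t)) + 44 * ln (real d)"
      using play_x_regret[OF T u] ln by simp
    have "- ?S \<le> - (\<Sum>t=1..T. loss A (x t) v + loss A (x (Suc t)) v) + 44 * ln (real d)"
      using play_y_regret[OF v, of T] ln
      by (simp add: loss_B play_in_prob_simplex v sum_negf sum.distrib sum_subtractf)
    \<comment> \<open>Shifting the index replaces \<open>x (Suc t)\<close> by \<open>x t\<close> up
      to a telescoped boundary term, so that only the average of \<open>x 1\<close> to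
      \<open>x T\<close> appears.\<close>
    also have "(\<Sum>t=1..T. loss A (x t) v + loss A (x (Suc t)) v) =
        2 * (\<Sum>t=1..T. loss A (x t) v) + loss A (x (Suc T)) v - loss A (x 1) v"
      using sum_Suc_diff[of 1 T "\<lambda>t. loss A (x t) v"] T by (simp add: sum.distrib sum_subtractf)
    finally have 2: "2 * (\<Sum>t=1..T. loss A (x t) v) \<le> ?S + 44 * ln (real d) + (loss A (x 1) v - loss A (x (Suc T)) v)"
      by simp
    have "loss A (x 1) v - loss A (x (Suc T)) v \<le> 4 * ln (real d1)"
      using linear_on_simplex_diff_le[OF linear_loss_left[OF game v]
          play_in_prob_simplex(1)[of 1] play_in_prob_simplex(1)[of "Suc T"] pos(1)]
      by (simp add: play_in_prob_simplex)
    \<comment> \<open>Two regret bounds and the boundary term add up to 44 + 44 + 4 = 92, and the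
      factor 2 on the sums halves this to 46.\<close>
    with 1 2 ln have "(\<Sum>t=1..T. loss A (x t) v) \<le> (\<Sum>t=1..T. loss A u (y t)) + 46 * ln (real d)"
      by linarith
    with T have "(\<Sum>t=1..T. loss A (x t) v) / real T \<le>
        ((\<Sum>t=1..T. loss A u (y t)) + 46 * ln (real d)) / real T"
      by (intro divide_right_mono) auto
    then show ?thesis
      using u v A by (simp add: loss_average_left[of A d1 d2] loss_average_right[of A d1 d2]
          prob_simplex_carrier play_in_prob_simplex add_divide_distrib)
  qed
  show ?thesis
    unfolding nash_equilibrium_def prod.case
  proof (intro conjI ballI avg)
    \<comment> \<open>Each player's condition takes the opponent's or the own average for one
      argument of the gap and a deviation for the other.\<close>
    show "loss A ?x ?y \<le> loss A x' ?y + 46 * ln (real d) / real T" if "x' \<in> prob_simplex d1" for x'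
      using gap[OF that avg(2)] .
    show "loss B ?x ?y \<le> loss B ?x y' + 46 * ln (real d) / real T" if "y' \<in> prob_simplex d2" for y'
      using gap[OF avg(1) that] avg that by (simp add: loss_B)
  qed
qed

end

theorem corollary1:
  "\<exists>C>(0::real). \<exists>algx algy. online_algorithm algx \<and> online_algorithm algy \<and>
    (\<forall>d d1 d2 A B x y.
       normal_form_game d1 d2 A B \<and> d1 \<le> d \<and> d2 \<le> d \<and>
       x = play_x algx algy d1 d2 A B \<and> y = play_y algx algy d1 d2 A B \<longrightarrow>
       (\<forall>T\<ge>1.
          (zero_sum A B \<longrightarrow>
             (\<exists>\<epsilon>. \<epsilon> \<le> C * ln (real d) / real T \<and>
                nash_equilibrium d1 d2 A B \<epsilon> (average d1 T x, average d2 T y))) \<and>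
          (general_sum A B \<longrightarrow>
             (\<exists>\<epsilon>. \<epsilon> \<le> C * ln (real d) / real T \<and>
                coarse_correlated_equilibrium d1 d2 A B \<epsilon>
                  (pmf_of_multiset (alternating_profiles T x y))))))"
proof (rule exI[of _ 46], rule conjI, simp, rule exI[of _ hedge], rule exI[of _ hedge],
    intro conjI allI impI)
  fix d d1 d2 :: nat and A B :: "real mat" and x y :: "nat \<Rightarrow> real vec" and T :: nat
  assume "normal_form_game d1 d2 A B \<and> d1 \<le> d \<and> d2 \<le> d \<and>
    x = play_x hedge hedge d1 d2 A B \<and> y = play_y hedge hedge d1 d2 A B" and T: "1 \<le> T"
  then have play: "normal_form_game d1 d2 A B"
      "x = play_x hedge hedge d1 d2 A B" "y = play_y hedge hedge d1 d2 A B"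
    and d: "d1 \<le> d" "d2 \<le> d" by auto
  show "\<exists>\<epsilon>. \<epsilon> \<le> 46 * ln (real d) / real T \<and>
      nash_equilibrium d1 d2 A B \<epsilon> (average d1 T x, average d2 T y)" if "zero_sum A B"
    using play_nash_equilibrium[OF play T d that] by blast
  show "\<exists>\<epsilon>. \<epsilon> \<le> 46 * ln (real d) / real T \<and>
      coarse_correlated_equilibrium d1 d2 A B \<epsilon> (pmf_of_multiset (alternating_profiles T x y))"
    using play_coarse_correlated_equilibrium[OF play T d] by blast
qed (rule online_algorithm_hedge)+

end
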